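(* Let $(P,\mu,[-,-],\varepsilon,\alpha_P)$ be a color NHLP-algebra and $\beta:P\to P$ an even endomorphism. Then for any integer $n\ge1$, $(P,\mu_{\beta^n},[-,-]_{\beta^n},\varepsilon,\beta^n\circ\alpha_P)$ is a color NHLP-algebra, where for all $x,y\in\mathcal H(P)$ $$\mu_{\beta^n}(x,y):=\beta^n(\mu(x,y)),\qquad [x,y]_{\beta^n}:=\beta^n([x,y]).$$
   Context: $\mathbf K$ is a field of characteristic $0$ and $G$ is an abelian group (written additively). For a $G$-graded vector space $V$, $\mathcal H(V)$ is the set of homogeneous elements. A linear (or bilinear) map is even if it preserves degrees. A bicharacter is a map $\varepsilon:G\times G\to\mathbf K^*$ with $\varepsilon(a,b)\varepsilon(b,a)=1$, $\varepsilon(a,b+c)=\varepsilon(a,b)\varepsilon(a,c)$, $\varepsilon(a+b,c)=\varepsilon(a,c)\varepsilon(b,c)$. For homogeneous $x,y$ of degrees $a,b$ one writes $\varepsilon(x,y):=\varepsilon(a,b)$. A color NHLP-algebra (non-commutative Hom-Leibniz-Poisson algebra) $(P,\mu,[-,-],\varepsilon,\alpha_P)$ is a $G$-graded vector space $P$ with even bilinear maps $[-,-],\mu:P\otimes P\to P$, a bicharacter $\varepsilon$ and an even linear map $\alpha_P:P\to P$ such that for all homogeneous $x,y,z\in P$: (i) $[\alpha_P(x),[y,z]]=[[x,y],\alpha_P(z)]+\varepsilon(x,y)[\alpha_P(y),[x,z]]$; (ii) $\mu(\alpha_P(x),\mu(y,z))=\mu(\mu(x,y),\alpha_P(z))$;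 (iii) $[\alpha_P(x),\mu(y,z)]=\mu([x,y],\alpha_P(z))+\varepsilon(x,y)\mu(\alpha_P(y),[x,z])$. An even endomorphism $\beta$ of $P$ is an even linear map with $\beta(\mu(x,y))=\mu(\beta(x),\beta(y))$ and $\beta([x,y])=[\beta(x),\beta(y)]$. *)

theory Defs
  imports Complex_Main
begin

definition bicharacter :: "('g::ab_group_add \<Rightarrow> 'g \<Rightarrow> 'k::field) \<Rightarrow> bool" where
  "bicharacter \<epsilon> \<longleftrightarrow>
     (\<forall>a b. \<epsilon> a b \<noteq> 0) \<and>
     (\<forall>a b. \<epsilon> a b * \<epsilon> b a = 1) \<and>
     (\<forall>a b c. \<epsilon> a (b + c) = \<epsilon> a b * \<epsilon> a c) \<and>
     (\<forall>a b c. \<epsilon> (a + b) c = \<epsilon> a c * \<epsilon> b c)"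

text \<open>The vector space is the internal direct sum of the subspaces \<open>V g\<close>: every vector has
  exactly one finitely supported decomposition into homogeneous components.\<close>

locale graded_vector_space = vector_space scale
  for scale :: "'k::field_char_0 \<Rightarrow> 'v::ab_group_add \<Rightarrow> 'v" +
  fixes V :: "'g::ab_group_add \<Rightarrow> 'v set"
  assumes subspace_component: "subspace (V g)"
    and direct_sum: "\<exists>!f. finite {g. f g \<noteq> 0} \<and> (\<forall>g. f g \<in> V g) \<and> v = (\<Sum>g | f g \<noteq> 0. f g)"

definition even_linear ::
  "('k::field_char_0 \<Rightarrow> 'v::ab_group_add \<Rightarrow> 'v) \<Rightarrow> ('g::ab_group_add \<Rightarrow> 'v set) \<Rightarrow> ('v \<Rightarrow> 'v) \<Rightarrow> bool" where
  "even_linear scale V f \<longleftrightarrow>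
     Vector_Spaces.linear scale scale f \<and> (\<forall>g. \<forall>x \<in> V g. f x \<in> V g)"

definition even_bilinear ::
  "('k::field_char_0 \<Rightarrow> 'v::ab_group_add \<Rightarrow> 'v) \<Rightarrow> ('g::ab_group_add \<Rightarrow> 'v set) \<Rightarrow> ('v \<Rightarrow> 'v \<Rightarrow> 'v) \<Rightarrow> bool" where
  "even_bilinear scale V m \<longleftrightarrow>
     (\<forall>x. Vector_Spaces.linear scale scale (\<lambda>y. m x y)) \<and>
     (\<forall>y. Vector_Spaces.linear scale scale (\<lambda>x. m x y)) \<and>
     (\<forall>a b. \<forall>x \<in> V a. \<forall>y \<in> V b. m x y \<in> V (a + b))"

text \<open>Identities over homogeneous elements are quantified over degrees \<open>a\<close>, \<open>b\<close>, \<open>c\<close> and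
  elements of those degrees, so that \<open>\<epsilon>(x,y)\<close> is \<open>\<epsilon> a b\<close>; the vector \<open>0\<close> lies in
  every component, where the identities hold trivially.\<close>

locale color_NHLP_algebra = graded_vector_space scale V
  for scale :: "'k::field_char_0 \<Rightarrow> 'v::ab_group_add \<Rightarrow> 'v"
    and V :: "'g::ab_group_add \<Rightarrow> 'v set" +
  fixes \<mu> :: "'v \<Rightarrow> 'v \<Rightarrow> 'v"
    and br :: "'v \<Rightarrow> 'v \<Rightarrow> 'v"
    and \<epsilon> :: "'g \<Rightarrow> 'g \<Rightarrow> 'k"
    and \<alpha> :: "'v \<Rightarrow> 'v"
  assumes even_bilinear_mult: "even_bilinear scale V \<mu>"
    and even_bilinear_bracket: "even_bilinear scale V br"
    and bicharacter: "bicharacter \<epsilon>"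
    and even_linear_twist: "even_linear scale V \<alpha>"
    and hom_leibniz: "\<lbrakk>x \<in> V a; y \<in> V b; z \<in> V c\<rbrakk> \<Longrightarrow>
      br (\<alpha> x) (br y z) = br (br x y) (\<alpha> z) + scale (\<epsilon> a b) (br (\<alpha> y) (br x z))"
    and hom_associative: "\<lbrakk>x \<in> V a; y \<in> V b; z \<in> V c\<rbrakk> \<Longrightarrow>
      \<mu> (\<alpha> x) (\<mu> y z) = \<mu> (\<mu> x y) (\<alpha> z)"
    and hom_poisson: "\<lbrakk>x \<in> V a; y \<in> V b; z \<in> V c\<rbrakk> \<Longrightarrow>
      br (\<alpha> x) (\<mu> y z) = \<mu> (br x y) (\<alpha> z) + scale (\<epsilon> a b) (\<mu> (\<alpha> y) (br x z))"

definition even_endomorphism ::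
  "('k::field_char_0 \<Rightarrow> 'v::ab_group_add \<Rightarrow> 'v) \<Rightarrow> ('g::ab_group_add \<Rightarrow> 'v set) \<Rightarrow>
   ('v \<Rightarrow> 'v \<Rightarrow> 'v) \<Rightarrow> ('v \<Rightarrow> 'v \<Rightarrow> 'v) \<Rightarrow> ('v \<Rightarrow> 'v) \<Rightarrow> bool" where
  "even_endomorphism scale V \<mu> br \<beta> \<longleftrightarrow>
     even_linear scale V \<beta> \<and>
     (\<forall>x y. \<beta> (\<mu> x y) = \<mu> (\<beta> x) (\<beta> y)) \<and>
     (\<forall>x y. \<beta> (br x y) = br (\<beta> x) (\<beta> y))"

end

theory Submission imports Defs begin

text \<open>Yau twisting: if \<open>\<gamma>\<close> is an even endomorphism, each identity for the structure twisted by
  \<open>\<gamma>\<close> is the image under \<open>\<gamma> \<circ> \<gamma>\<close> of the corresponding original identity.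
  Apply this to \<open>\<gamma> = \<beta>\<^sup>n\<close>.\<close>

lemma even_linear_compose:
  assumes "even_linear scale V f" "even_linear scale V g"
  shows "even_linear scale V (g \<circ> f)"
  using assms unfolding even_linear_def
  by (auto intro: Vector_Spaces.linear_compose)

lemma even_bilinear_compose:
  assumes m: "even_bilinear scale V m" and f: "even_linear scale V f"
  shows "even_bilinear scale V (\<lambda>x y. f (m x y))"
proof -
  have "Vector_Spaces.linear scale scale (\<lambda>y. f (m x y))" for x
    using m f Vector_Spaces.linear_compose[of scale scale "m x" scale f]
    by (simp add: even_bilinear_def even_linear_def o_def)
  moreover have "Vector_Spaces.linear scale scale (\<lambda>x. f (m x y))" for y
    using m f Vector_Spaces.linear_compose[of scale scale "\<lambda>x. m x y" scale f]
    by (simp add: even_bilinear_def even_linear_def o_def)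
  ultimately show ?thesis
    using m f by (simp add: even_bilinear_def even_linear_def)
qed

lemma even_endomorphism_funpow:
  assumes "vector_space scale" and \<beta>: "even_endomorphism scale V \<mu> br \<beta>"
  shows "even_endomorphism scale V \<mu> br (\<beta> ^^ n)"
proof (induction n)
  case 0
  show ?case
    \<comment> \<open>The zeroth power is the identity, whose linearity comes from the vector space
      axioms.\<close>
    using vector_space.linear_id[OF assms(1)]
    by (simp add: even_endomorphism_def even_linear_def id_def)
next
  case (Suc n)
  then show ?case
    \<comment> \<open>\<open>funpow\<close> peels off the outermost factor: the next power is
      \<open>\<beta> \<circ> \<beta> ^^ n\<close>.\<close>
    using \<beta> even_linear_compose[of scale V "\<beta> ^^ n" \<beta>]
    by (simp add: even_endomorphism_def o_def)
qed

text \<open>In each nested product the outer operation contributes one \<open>\<gamma>\<close>. Its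
  two arguments also carry one each, from the inner operation and from the twisted
  \<open>\<alpha>\<close>; multiplicativity merges these into a second outer
  \<open>\<gamma>\<close>.\<close>

lemma (in color_NHLP_algebra) color_NHLP_algebra_twist:
  assumes \<gamma>: "even_endomorphism scale V \<mu> br \<gamma>"
  shows "color_NHLP_algebra scale V (\<lambda>x y. \<gamma> (\<mu> x y)) (\<lambda>x y. \<gamma> (br x y)) \<epsilon> (\<gamma> \<circ> \<alpha>)"
proof -
  \<comment> \<open>\<open>mult\<close> and \<open>bracket\<close> are oriented so that rewriting
    moves \<open>\<gamma>\<close> outward, exposing the original identity under two copies of
    \<open>\<gamma>\<close>.\<close>
  have even: "even_linear scale V \<gamma>"
    and mult: "\<mu> (\<gamma> x) (\<gamma> y) = \<gamma> (\<mu> x y)"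
    and bracket: "br (\<gamma> x) (\<gamma> y) = \<gamma> (br x y)" for x y
    using \<gamma> by (auto simp: even_endomorphism_def)
  interpret \<gamma>: Vector_Spaces.linear scale scale \<gamma>
    using even by (simp add: even_linear_def)
  show ?thesis
  proof unfold_locales
    fix x y z a b c
    assume xyz: "x \<in> V a" "y \<in> V b" "z \<in> V c"
    show "\<gamma> (br ((\<gamma> \<circ> \<alpha>) x) (\<gamma> (br y z))) =
        \<gamma> (br (\<gamma> (br x y)) ((\<gamma> \<circ> \<alpha>) z)) + scale (\<epsilon> a b) (\<gamma> (br ((\<gamma> \<circ> \<alpha>) y) (\<gamma> (br x z))))"
      \<comment> \<open>Linearity carries both copies of \<open>\<gamma>\<close> through the sum and
        past the scalar \<open>\<epsilon> a b\<close>.\<close>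
      by (simp add: bracket hom_leibniz[OF xyz] \<gamma>.add \<gamma>.scale)
    show "\<gamma> (\<mu> ((\<gamma> \<circ> \<alpha>) x) (\<gamma> (\<mu> y z))) = \<gamma> (\<mu> (\<gamma> (\<mu> x y)) ((\<gamma> \<circ> \<alpha>) z))"
      by (simp add: mult hom_associative[OF xyz])
    show "\<gamma> (br ((\<gamma> \<circ> \<alpha>) x) (\<gamma> (\<mu> y z))) =
        \<gamma> (\<mu> (\<gamma> (br x y)) ((\<gamma> \<circ> \<alpha>) z)) + scale (\<epsilon> a b) (\<gamma> (\<mu> ((\<gamma> \<circ> \<alpha>) y) (\<gamma> (br x z))))"
      by (simp add: bracket mult hom_poisson[OF xyz] \<gamma>.add \<gamma>.scale)
  \<comment> \<open>The grading and \<open>\<epsilon>\<close> are unchanged; evenness of the new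
    maps is closure under composition with \<open>\<gamma>\<close>.\<close>
  qed (fact even_bilinear_compose[OF even_bilinear_mult even]
      even_bilinear_compose[OF even_bilinear_bracket even]
      bicharacter even_linear_compose[OF even_linear_twist even])+
qed

theorem theorem4p2:
  fixes scale :: "'k::field_char_0 \<Rightarrow> 'v::ab_group_add \<Rightarrow> 'v"
    and V :: "'g::ab_group_add \<Rightarrow> 'v set"
    and \<mu> br :: "'v \<Rightarrow> 'v \<Rightarrow> 'v"
    and \<epsilon> :: "'g \<Rightarrow> 'g \<Rightarrow> 'k"
    and \<alpha> \<beta> :: "'v \<Rightarrow> 'v"
    and n :: nat
  assumes "color_NHLP_algebra scale V \<mu> br \<epsilon> \<alpha>"
    and "even_endomorphism scale V \<mu> br \<beta>"
    and "n \<ge> 1"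
  shows "color_NHLP_algebra scale V
           (\<lambda>x y. (\<beta> ^^ n) (\<mu> x y)) (\<lambda>x y. (\<beta> ^^ n) (br x y)) \<epsilon> ((\<beta> ^^ n) \<circ> \<alpha>)"
proof -
  interpret color_NHLP_algebra scale V \<mu> br \<epsilon> \<alpha>
    by (fact assms(1))
  show ?thesis
    by (intro color_NHLP_algebra_twist even_endomorphism_funpow vector_space_axioms assms(2))
qed

end
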